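(* Let $N\ge 3$, let $a,b>0$, and let $E=\{(x,y)\in\mathbb{R}^2:\ x^2/a^2+y^2/b^2=1\}$, with center the origin $O$. Consider a family of $N$-periodic billiard trajectories in $E$. For a trajectory of the family with consecutive vertices $P_1,\dots,P_N$ (indices modulo $N$), let $P_i'$ be the intersection of the tangent lines to $E$ at $P_i$ and $P_{i+1}$, and let $M_i$ be the midpoint of the side $P_iP_{i+1}$. Then, for every trajectory of the family, the $N$ lines $P_i'M_i$, $i=1,\dots,N$, concur at the center $O$; in particular their point of concurrence is stationary over the family.
   Context: Elliptic billiard: a particle moves in straight lines at constant speed inside $E$ and bounces elastically on $E$, i.e. at each bounce point the incoming and outgoing segments make equal angles with the normal to $E$. An $N$-periodic trajectory (orbit) is a billiard trajectory that closes after $N$ bounces, i.e. a closed polygon with $N$ vertices on $E$ satisfying this reflection law at each vertex. A family of $N$-periodic trajectories is the one-parameter family of $N$-periodic trajectories in $E$ given by Poncelet's porism: all of them have their sides tangent to one and the same ellipse (the caustic), nested in $E$ and confocal with $E$, and every point of $E$ is a vertex of a member of the family. The polygon with vertices $P_1',\dots,P_N'$, whose sides are tangent to $E$ at the vertices of the trajectory, is called the tangential polygon of the trajectory (for $N=3$ it is the excentral triangle). *)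

theory Defs
  imports "HOL-Analysis.Analysis"
begin

type_synonym point = "real \<times> real"

definition ellipse :: "real \<Rightarrow> real \<Rightarrow> point set" where
  "ellipse a b = {(x, y). x\<^sup>2 / a\<^sup>2 + y\<^sup>2 / b\<^sup>2 = 1}"

definition ellipse_interior :: "real \<Rightarrow> real \<Rightarrow> point set" where
  "ellipse_interior a b = {(x, y). x\<^sup>2 / a\<^sup>2 + y\<^sup>2 / b\<^sup>2 < 1}"

(* Either semi-axis may be the major one; a circle has its centre as only focus. *)
definition foci :: "real \<Rightarrow> real \<Rightarrow> point set" where
  "foci a b =
     (if b \<le> a then {(sqrt (a\<^sup>2 - b\<^sup>2), 0), (- sqrt (a\<^sup>2 - b\<^sup>2), 0)}
      else {(0, sqrt (b\<^sup>2 - a\<^sup>2)), (0, - sqrt (b\<^sup>2 - a\<^sup>2))})"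

(* Half the gradient of x^2/a^2 + y^2/b^2 at p: a normal vector of the ellipse at p. *)
definition ellipse_normal :: "real \<Rightarrow> real \<Rightarrow> point \<Rightarrow> point" where
  "ellipse_normal a b p = (fst p / a\<^sup>2, snd p / b\<^sup>2)"

definition ellipse_tangent :: "real \<Rightarrow> real \<Rightarrow> point \<Rightarrow> point set" where
  "ellipse_tangent a b p = {z. (z - p) \<bullet> ellipse_normal a b p = 0}"

(* Reflection in the line orthogonal to n. *)
definition reflect_perp :: "point \<Rightarrow> point \<Rightarrow> point" where
  "reflect_perp n v = v - (2 * (v \<bullet> n) / (n \<bullet> n)) *\<^sub>R n"

(* An N-periodic trajectory is the N-periodic sequence of its bounce points, so that indices
   are read modulo N. The last clause is the elastic bounce: the outgoing unit velocity is
   the incoming one with its normal component reversed. Requiring only equal unsigned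
   angles with the normal would also admit a particle that is sent straight back. *)
definition periodic_billiard_trajectory ::
    "real \<Rightarrow> real \<Rightarrow> nat \<Rightarrow> (int \<Rightarrow> point) \<Rightarrow> bool" where
  "periodic_billiard_trajectory a b N P \<longleftrightarrow>
     (\<forall>i. P (i + int N) = P i) \<and>
     (\<forall>i. P i \<in> ellipse a b) \<and>
     (\<forall>i. P i \<noteq> P (i + 1)) \<and>
     (\<forall>i. sgn (P (i + 1) - P i) = reflect_perp (ellipse_normal a b (P i)) (sgn (P i - P (i - 1))))"

definition side_line :: "(int \<Rightarrow> point) \<Rightarrow> int \<Rightarrow> point set" where
  "side_line P i = affine hull {P i, P (i + 1)}"

(* An ellipse with the same foci has the same centre and axes, so every confocal ellipse
   is of the form "ellipse a' b'". *)
definition trajectory_family ::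
    "real \<Rightarrow> real \<Rightarrow> nat \<Rightarrow> (int \<Rightarrow> point) set \<Rightarrow> bool" where
  "trajectory_family a b N F \<longleftrightarrow>
     (\<forall>P\<in>F. periodic_billiard_trajectory a b N P) \<and>
     (\<exists>a'>0. \<exists>b'>0.
        foci a' b' = foci a b \<and>
        ellipse a' b' \<subseteq> ellipse_interior a b \<and>
        (\<forall>P\<in>F. \<forall>i. \<exists>q\<in>ellipse a' b'. side_line P i = ellipse_tangent a' b' q)) \<and>
     (\<forall>p\<in>ellipse a b. \<exists>P\<in>F. \<exists>i. P i = p)"

(* Meaningful only when the two tangents meet in exactly one point. *)
definition tangential_vertex :: "real \<Rightarrow> real \<Rightarrow> (int \<Rightarrow> point) \<Rightarrow> int \<Rightarrow> point" where
  "tangential_vertex a b P i =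
     (THE Q. Q \<in> ellipse_tangent a b (P i) \<inter> ellipse_tangent a b (P (i + 1)))"

definition side_midpoint :: "(int \<Rightarrow> point) \<Rightarrow> int \<Rightarrow> point" where
  "side_midpoint P i = midpoint (P i) (P (i + 1))"

end

theory Submission
  imports Defs
begin

text \<open>
  For \<open>p\<close>, \<open>q\<close> on the ellipse put \<open>\<langle>p, q\<rangle> = p \<bullet> ellipse_normal a b q\<close>, a symmetric positive definite
  form with \<open>\<langle>p, p\<rangle> = 1\<close> on the ellipse. The tangent at \<open>p\<close> is \<open>\<langle>z, p\<rangle> = 1\<close>, so the tangents at \<open>p\<close>
  and \<open>q\<close> meet in \<open>(p + q) / (1 + \<langle>p, q\<rangle>)\<close>, a multiple of the midpoint \<open>(p + q) / 2\<close>. The chord is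
  not a diameter because it touches an ellipse with the same centre. If consecutive lines coincided,
  the trajectory would run back and forth along one chord normal to the ellipse at both ends, and
  parallel normals at distinct points force that chord to be a diameter.
\<close>

lemma ellipse_normal_add: "ellipse_normal a b (p + q) = ellipse_normal a b p + ellipse_normal a b q"
  by (simp add: ellipse_normal_def add_divide_distrib)

lemma ellipse_normal_diff: "ellipse_normal a b (p - q) = ellipse_normal a b p - ellipse_normal a b q"
  by (simp add: ellipse_normal_def diff_divide_distrib)

lemma ellipse_normal_scaleR: "ellipse_normal a b (c *\<^sub>R p) = c *\<^sub>R ellipse_normal a b p"
  by (simp add: ellipse_normal_def)

lemma inner_ellipse_normal_commute: "q \<bullet> ellipse_normal a b p = p \<bullet> ellipse_normal a b q"
  by (simp add: ellipse_normal_def inner_prod_def mult.commute)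

lemma inner_ellipse_normal_pos:
  assumes "a \<noteq> 0" "b \<noteq> 0" "p \<noteq> 0"
  shows "p \<bullet> ellipse_normal a b p > 0"
proof (cases p)
  case (Pair x y)
  have "x \<noteq> 0 \<or> y \<noteq> 0"
    using assms(3) Pair by (auto simp: zero_prod_def)
  then have "x\<^sup>2 / a\<^sup>2 + y\<^sup>2 / b\<^sup>2 > 0"
    using assms(1,2) by (auto intro: add_pos_nonneg add_nonneg_pos)
  then show ?thesis
    by (simp add: Pair ellipse_normal_def inner_prod_def power2_eq_square)
qed

lemma mem_ellipse_iff: "p \<in> ellipse a b \<longleftrightarrow> p \<bullet> ellipse_normal a b p = 1"
  by (cases p) (simp add: ellipse_def ellipse_normal_def inner_prod_def power2_eq_square)

lemma mem_ellipse_tangent_iff: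
  "p \<in> ellipse a b \<Longrightarrow> z \<in> ellipse_tangent a b p \<longleftrightarrow> z \<bullet> ellipse_normal a b p = 1"
  by (simp add: ellipse_tangent_def mem_ellipse_iff inner_diff_left)

text \<open>A vector parallel to \<open>p\<close> equals its projection onto \<open>p\<close> in the
  form, so \<open>q = t *\<^sub>R p\<close> with t = \<langle>q, p\<rangle>; since the form is 1 at
  both points, t * t = 1.\<close>

lemma ellipse_parallel_cases:
  assumes "p \<in> ellipse a b" "q \<in> ellipse a b" "fst p * snd q = snd p * fst q"
  shows "q = p \<or> q = - p"
proof -
  define t where "t = q \<bullet> ellipse_normal a b p"
  obtain x y u v where pq: "p = (x, y)" "q = (u, v)"
    by (cases p, cases q)
  have par: "x * v = y * u"
    using assms(3) pq by simp
  have one: "x * x / a\<^sup>2 + y * y / b\<^sup>2 = 1"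
    using assms(1) by (simp add: pq ellipse_def power2_eq_square)
  have t: "t = u * x / a\<^sup>2 + v * y / b\<^sup>2"
    by (simp add: t_def pq ellipse_normal_def inner_prod_def)
  have "t * x = u * (x * x / a\<^sup>2) + y * (x * v) / b\<^sup>2"
    by (simp add: t algebra_simps)
  also have "\<dots> = u * (x * x / a\<^sup>2 + y * y / b\<^sup>2)"
    unfolding par by (simp add: algebra_simps)
  finally have tx: "t * x = u"
    by (simp add: one)
  have "t * y = x * (y * u) / a\<^sup>2 + v * (y * y / b\<^sup>2)"
    by (simp add: t algebra_simps)
  also have "\<dots> = v * (x * x / a\<^sup>2 + y * y / b\<^sup>2)"
    unfolding par[symmetric] by (simp add: algebra_simps)
  finally have ty: "t * y = v"
    by (simp add: one)
  have q: "q = t *\<^sub>R p"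
    using tx ty pq by simp
  have "t * t = 1"
    using assms(1,2) unfolding q mem_ellipse_iff by (simp add: ellipse_normal_scaleR)
  then have "t = 1 \<or> t = -1"
    by (simp add: square_eq_1_iff)
  then show ?thesis
    using q by auto
qed

text \<open>Strict Cauchy-Schwarz: on the ellipse the form takes the values 2 - 2\<langle>p,
  q\<rangle> at \<open>q - p\<close> and 2 + 2\<langle>p, q\<rangle> at \<open>q + p\<close>, and
  both are positive.\<close>

lemma ellipse_form_bounds:
  assumes "a \<noteq> 0" "b \<noteq> 0" "p \<in> ellipse a b" "q \<in> ellipse a b" "q \<noteq> p" "q \<noteq> - p"
  shows "p \<bullet> ellipse_normal a b q < 1" "- 1 < p \<bullet> ellipse_normal a b q"
proof -
  note form = ellipse_normal_add ellipse_normal_diff inner_add inner_diff mem_ellipse_iff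
    inner_ellipse_normal_commute[of q a b p]
  have "q - p \<noteq> 0" "q + p \<noteq> 0"
    using assms(5,6) by (auto simp: eq_neg_iff_add_eq_0)
  then have "(q - p) \<bullet> ellipse_normal a b (q - p) > 0" "(q + p) \<bullet> ellipse_normal a b (q + p) > 0"
    using assms(1,2) by (blast intro: inner_ellipse_normal_pos)+
  then show "p \<bullet> ellipse_normal a b q < 1" "- 1 < p \<bullet> ellipse_normal a b q"
    using assms(3,4) by (simp_all add: form)
qed

lemma ellipse_tangents_Int:
  assumes "a \<noteq> 0" "b \<noteq> 0" "p \<in> ellipse a b" "q \<in> ellipse a b" "q \<noteq> p" "q \<noteq> - p"
  shows "ellipse_tangent a b p \<inter> ellipse_tangent a b q =
    {(1 / (1 + p \<bullet> ellipse_normal a b q)) *\<^sub>R (p + q)}" (is "?L = {?Q}")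
proof -
  have t: "- 1 < p \<bullet> ellipse_normal a b q"
    using assms by (rule ellipse_form_bounds)
  have Q: "?Q \<bullet> ellipse_normal a b p = 1" "?Q \<bullet> ellipse_normal a b q = 1"
    using t assms(3,4)
    by (simp_all add: mem_ellipse_iff inner_add_left inner_ellipse_normal_commute[of q a b p]
        add_divide_distrib[symmetric] add.commute)
  \<comment> \<open>Uniqueness: the difference of two common points is orthogonal to both normals.
    Cramer's rule makes it vanish, the determinant being nonzero because \<open>p\<close> and
    \<open>q\<close> are not parallel.\<close>
  have "z = ?Q" if z: "z \<bullet> ellipse_normal a b p = 1" "z \<bullet> ellipse_normal a b q = 1" for z
  proof -
    obtain d e where de: "z - ?Q = (d, e)"
      by fastforce
    obtain x y u v where pq: "p = (x, y)" "q = (u, v)"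
      by (cases p, cases q)
    have "(z - ?Q) \<bullet> ellipse_normal a b p = 0" "(z - ?Q) \<bullet> ellipse_normal a b q = 0"
      using z Q by (simp_all only: inner_diff_left diff_self)
    then have eqs: "(d / a\<^sup>2) * x + (e / b\<^sup>2) * y = 0" "(d / a\<^sup>2) * u + (e / b\<^sup>2) * v = 0"
      unfolding de by (simp_all add: pq ellipse_normal_def inner_prod_def)
    have det: "x * v - y * u \<noteq> 0"
      using ellipse_parallel_cases[OF assms(3,4)] assms(5,6) pq by auto
    have "(d / a\<^sup>2) * (x * v - y * u) = 0" "(e / b\<^sup>2) * (x * v - y * u) = 0"
      using eqs by algebra+
    then have "d = 0" "e = 0"
      using det assms(1,2) by simp_all
    then show "z = ?Q"
      using de by (simp add: zero_prod_def[symmetric])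
  qed
  then have "z \<in> ?L \<longleftrightarrow> z = ?Q" for z
    unfolding Int_iff mem_ellipse_tangent_iff[OF assms(3)] mem_ellipse_tangent_iff[OF assms(4)]
    using Q by blast
  then show ?thesis
    by blast
qed

lemma affine_hull_two_scaleR:
  fixes s :: "'a::real_vector"
  assumes "x \<noteq> y"
  shows "affine hull {x *\<^sub>R s, y *\<^sub>R s} = range (\<lambda>c. c *\<^sub>R s)"
proof -
  have "c *\<^sub>R s \<in> affine hull {x *\<^sub>R s, y *\<^sub>R s}" for c
  proof -
    \<comment> \<open>The weights are the barycentric coordinates of \<open>c\<close> with respect
      to \<open>x\<close> and \<open>y\<close>.\<close>
    have "c = (c - y) / (x - y) * x + (x - c) / (x - y) * y"
      using assms by (simp add: divide_simps) (simp add: algebra_simps)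
    then have "c *\<^sub>R s = ((c - y) / (x - y)) *\<^sub>R (x *\<^sub>R s) + ((x - c) / (x - y)) *\<^sub>R (y *\<^sub>R s)"
      by (metis scaleR_left_distrib scaleR_scaleR)
    moreover have "(c - y) / (x - y) + (x - c) / (x - y) = 1"
      using assms by (simp add: add_divide_distrib[symmetric])
    ultimately show ?thesis
      unfolding affine_hull_2 by blast
  qed
  then show ?thesis
    by (auto simp: affine_hull_2 simp flip: scaleR_left_distrib)
qed

lemma zero_notin_ellipse_tangent: "q \<in> ellipse a b \<Longrightarrow> 0 \<notin> ellipse_tangent a b q"
  by (simp add: mem_ellipse_tangent_iff)

lemma zero_mem_affine_hull_antipodal: "(0::'a::real_vector) \<in> affine hull {p, - p}"
proof -
  have "0 = (1/2) *\<^sub>R p + (1/2) *\<^sub>R (- p)"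
    by simp
  moreover have "1/2 + 1/2 = (1::real)"
    by simp
  ultimately show ?thesis
    unfolding affine_hull_2 by blast
qed

text \<open>Since \<langle>q - p, q + p\<rangle> = \<langle>q, q\<rangle> - \<langle>p, p\<rangle> =
  0, a chord is conjugate to the diameter through its midpoint. Two chords from \<open>q\<close>
  with midpoints on the line spanned by \<open>z\<close> are thus both conjugate to \<open>z\<close>
  and have the same second endpoint.\<close>

lemma ellipse_chords_conjugate_eq:
  assumes "a \<noteq> 0" "b \<noteq> 0" "z \<noteq> 0"
    and "p \<in> ellipse a b" "q \<in> ellipse a b" "r \<in> ellipse a b"
    and "z \<in> range (\<lambda>c. c *\<^sub>R (p + q))" "z \<in> range (\<lambda>c. c *\<^sub>R (q + r))"
    and "p + q \<noteq> 0" "q + r \<noteq> 0"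
  shows "r = p"
proof -
  \<comment> \<open>The equation \<langle>m z - q, m z - q\<rangle> = \<langle>q, q\<rangle> in m
    has the root 0, which belongs to the excluded point \<open>- q\<close>, and the root
    \<open>k\<close>.\<close>
  define k where "k = 2 * (q \<bullet> ellipse_normal a b z) / (z \<bullet> ellipse_normal a b z)"
  have zz: "z \<bullet> ellipse_normal a b z > 0"
    using assms(1-3) by (rule inner_ellipse_normal_pos)
  \<comment> \<open>The line through \<open>q\<close> conjugate to \<open>z\<close> meets the ellipse again only in \<open>k z - q\<close>.\<close>
  have *: "s = k *\<^sub>R z - q" if s: "s \<in> ellipse a b" "z = c *\<^sub>R (q + s)" "q + s \<noteq> 0" for s c
  proof -
    define m where "m = inverse c"
    have "c \<noteq> 0"
      using s(2) assms(3) by auto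
    then have m: "s = m *\<^sub>R z - q" and "m \<noteq> 0"
      using s(2) by (simp_all add: m_def)
    have "(m *\<^sub>R z - q) \<bullet> ellipse_normal a b (m *\<^sub>R z - q) = q \<bullet> ellipse_normal a b q"
      using s(1) assms(5) by (simp add: m mem_ellipse_iff)
    then have "m * (m * (z \<bullet> ellipse_normal a b z) - 2 * (q \<bullet> ellipse_normal a b z)) = 0"
      by (simp add: ellipse_normal_diff ellipse_normal_scaleR inner_diff
          inner_ellipse_normal_commute[of z a b q] algebra_simps)
    then have "m = k"
      using \<open>m \<noteq> 0\<close> zz by (simp add: k_def field_simps)
    then show ?thesis
      using m by simp
  qed
  have "p = k *\<^sub>R z - q"
    using *[OF assms(4)] assms(7,9) unfolding add.commute[of p] by blast
  moreover have "r = k *\<^sub>R z - q"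
    using *[OF assms(6)] assms(8,10) by blast
  ultimately show ?thesis
    by simp
qed

text \<open>The reflection negates only multiples of \<open>n\<close>. Thus a particle sent straight
  back has arrived along the normal.\<close>

lemma reflect_perp_reverse:
  assumes "reflect_perp n (sgn v) = sgn (- v)"
  shows "\<exists>k. v = k *\<^sub>R n"
proof
  have "2 *\<^sub>R sgn v = (2 * (sgn v \<bullet> n) / (n \<bullet> n)) *\<^sub>R n"
    using assms by (simp add: reflect_perp_def sgn_minus scaleR_2 algebra_simps)
  then have "(1/2) *\<^sub>R (2 *\<^sub>R sgn v) = (1/2) *\<^sub>R ((2 * (sgn v \<bullet> n) / (n \<bullet> n)) *\<^sub>R n)"
    by simp
  then have "sgn v = ((sgn v \<bullet> n) / (n \<bullet> n)) *\<^sub>R n"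
    by simp
  moreover have "v = norm v *\<^sub>R sgn v"
    by (cases "v = 0") (simp_all add: sgn_div_norm)
  ultimately show "v = (norm v * ((sgn v \<bullet> n) / (n \<bullet> n))) *\<^sub>R n"
    by (metis scaleR_scaleR)
qed

text \<open>The normal is a linear injective function of the point, so equating the two expressions
  for the chord gives \<open>k *\<^sub>R q = l *\<^sub>R p\<close>; hence \<open>p\<close> and
  \<open>q\<close> are parallel.\<close>

lemma ellipse_double_normal_diameter:
  assumes "a \<noteq> 0" "b \<noteq> 0" "p \<in> ellipse a b" "q \<in> ellipse a b" "q \<noteq> p"
    and k: "q - p = k *\<^sub>R ellipse_normal a b q" and l: "q - p = l *\<^sub>R ellipse_normal a b p"
  shows "q = - p"
proof -
  have nz: "k \<noteq> 0"
    using k assms(5) by auto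
  have "ellipse_normal a b (k *\<^sub>R q) = ellipse_normal a b (l *\<^sub>R p)"
    using k l by (simp add: ellipse_normal_scaleR)
  then have "k * fst q = l * fst p" "k * snd q = l * snd p"
    using assms(1,2) by (simp_all add: ellipse_normal_def)
  then have "k * (fst p * snd q - snd p * fst q) = 0"
    by algebra
  then show ?thesis
    using nz ellipse_parallel_cases[OF assms(3,4)] assms(5) by auto
qed

theorem theorem8:
  fixes a b :: real and N :: nat and F :: "(int \<Rightarrow> point) set"
  assumes "N \<ge> 3" and "a > 0" and "b > 0"
    and "trajectory_family a b N F"
  shows "\<forall>P\<in>F.
    (\<forall>i\<in>{1..int N}.
       ellipse_tangent a b (P i) \<inter> ellipse_tangent a b (P (i + 1)) = {tangential_vertex a b P i} \<and>
       tangential_vertex a b P i \<noteq> side_midpoint P i) \<and>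
    (\<Inter>i\<in>{1..int N}. affine hull {tangential_vertex a b P i, side_midpoint P i}) = {(0, 0)}"
proof
  fix P assume "P \<in> F"
  have ab: "a \<noteq> 0" "b \<noteq> 0"
    using assms(2,3) by auto
  have traj: "periodic_billiard_trajectory a b N P"
    using assms(4) \<open>P \<in> F\<close> by (simp add: trajectory_family_def)
  then have on: "P i \<in> ellipse a b" and ne: "P (i + 1) \<noteq> P i"
    and bounce: "reflect_perp (ellipse_normal a b (P i)) (sgn (P i - P (i - 1))) = sgn (P (i + 1) - P i)"
    for i unfolding periodic_billiard_trajectory_def by metis+
  \<comment> \<open>A diameter contains the centre, but a side line is tangent to the caustic, and
    there the tangent equation at the centre reads 0 = 1.\<close>
  have anti: "P (i + 1) \<noteq> - P i" for i
  proof
    assume "P (i + 1) = - P i"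
    then have "0 \<in> side_line P i"
      by (simp add: side_line_def zero_mem_affine_hull_antipodal)
    moreover obtain a' b' q where "q \<in> ellipse a' b'" "side_line P i = ellipse_tangent a' b' q"
      using assms(4) \<open>P \<in> F\<close> unfolding trajectory_family_def by metis
    ultimately show False
      using zero_notin_ellipse_tangent by auto
  qed
  then have sum_ne: "P i + P (i + 1) \<noteq> 0" for i
    by (metis add_eq_0_iff)
  define t where "t i = P i \<bullet> ellipse_normal a b (P (i + 1))" for i
  have t: "t i < 1" "- 1 < t i" for i
    unfolding t_def using ellipse_form_bounds[OF ab on on ne anti] by auto
  have Int: "ellipse_tangent a b (P i) \<inter> ellipse_tangent a b (P (i + 1)) =
      {(1 / (1 + t i)) *\<^sub>R (P i + P (i + 1))}" for i
    unfolding t_def by (rule ellipse_tangents_Int[OF ab on on ne anti])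
  then have tv: "tangential_vertex a b P i = (1 / (1 + t i)) *\<^sub>R (P i + P (i + 1))" for i
    unfolding tangential_vertex_def by simp
  have mid: "side_midpoint P i = (1 / 2) *\<^sub>R (P i + P (i + 1))" for i
    by (simp add: side_midpoint_def midpoint_def)
  \<comment> \<open>Equality would force \<open>t i = 1\<close>, which the strict upper bound
    excludes.\<close>
  have coeff: "1 / (1 + t i) \<noteq> 1 / 2" for i
    using t[of i] by (simp add: field_simps)
  have hull: "affine hull {tangential_vertex a b P i, side_midpoint P i} =
      range (\<lambda>c. c *\<^sub>R (P i + P (i + 1)))" for i
    unfolding tv mid by (rule affine_hull_two_scaleR[OF coeff])
  have "tangential_vertex a b P i \<noteq> side_midpoint P i" for i
    unfolding tv mid scaleR_cancel_right using coeff sum_ne by blast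
  moreover have "(\<Inter>i\<in>{1..int N}. range (\<lambda>c. c *\<^sub>R (P i + P (i + 1)))) = {0}"
  proof -
    have "z = 0" if z: "\<And>i. i \<in> {1..int N} \<Longrightarrow> z \<in> range (\<lambda>c. c *\<^sub>R (P i + P (i + 1)))" for z
    proof (rule ccontr)
      assume "z \<noteq> 0"
      have two_step: "P (i + 2) = P i" if "i \<in> {1, 2}" for i
        using ellipse_chords_conjugate_eq[OF ab \<open>z \<noteq> 0\<close> on on on, of i "i + 1" "i + 2"]
          z[of i] z[of "i + 1"] sum_ne[of i] sum_ne[of "i + 1"] that assms(1)
        by (auto simp: add.assoc)
      have P: "P 3 = P 1" "P 4 = P 2"
        using two_step[of 1] two_step[of 2] by simp_all
      \<comment> \<open>The particle comes back from \<open>P 2\<close> to \<open>P 3 = P 1\<close>,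
        so it hits the ellipse at \<open>P 2\<close> along the normal.\<close>
      obtain k where k: "P 2 - P 1 = k *\<^sub>R ellipse_normal a b (P 2)"
        using reflect_perp_reverse[of "ellipse_normal a b (P 2)" "P 2 - P 1"] bounce[of 2] P
        by auto
      \<comment> \<open>The bounce with index 3 takes place at \<open>P 1\<close> and leads from
        \<open>P 2\<close> back to \<open>P 4 = P 2\<close>; the bounce with index 1 would involve
        \<open>P 0\<close>.\<close>
      obtain l where l: "P 1 - P 2 = l *\<^sub>R ellipse_normal a b (P 1)"
        using reflect_perp_reverse[of "ellipse_normal a b (P 1)" "P 1 - P 2"] bounce[of 3] P
        by auto
      have "P 2 - P 1 = (- l) *\<^sub>R ellipse_normal a b (P 1)"
        using l by (metis minus_diff_eq scaleR_minus_left)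
      moreover have "P 2 \<noteq> P 1"
        using ne[of 1] by simp
      ultimately have "P 2 = - P 1"
        using ellipse_double_normal_diameter[OF ab on on _ k] by blast
      then show False
        using anti[of 1] by simp
    qed
    moreover have "0 \<in> range (\<lambda>c. c *\<^sub>R (P i + P (i + 1)))" for i
      by (metis rangeI scaleR_zero_left)
    ultimately show ?thesis
      by blast
  qed
  ultimately show "(\<forall>i\<in>{1..int N}.
       ellipse_tangent a b (P i) \<inter> ellipse_tangent a b (P (i + 1)) = {tangential_vertex a b P i} \<and>
       tangential_vertex a b P i \<noteq> side_midpoint P i) \<and>
    (\<Inter>i\<in>{1..int N}. affine hull {tangential_vertex a b P i, side_midpoint P i}) = {(0, 0)}"
    unfolding hull by (simp add: Int tv zero_prod_def)
qed

end
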